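(* For any integers $m,n\ge 0$, $\gamma_f^\infty(P_n\boxtimes P_m)\le\frac{mn}{9}+\frac{16(m+n)}{9}+\frac{114}{9}$.
   Context: $P_n$ is the path on $n$ vertices ($P_0$ being the graph with no vertices, for which $\gamma_f^\infty=0$), and $\boxtimes$ denotes the strong product of graphs: $(a,b)$ and $(a',b')$ are adjacent iff they are distinct, $a=a'$ or $a\sim a'$, and $b=b'$ or $b\sim b'$. $N(v)$ is the open neighbourhood and $N[v]=N(v)\cup\{v\}$ the closed neighbourhood of $v$. A fractional dominating function of a finite simple graph $G=(V,E)$ is a function $w:V\to[0,\infty)$ with $\sum_{x\in N[v]}w(x)\ge 1$ for all $v\in V$; its total weight is $\sum_{x\in V}w(x)$. Fractional eternal domination. Fix $S$. The defender chooses a fractional dominating function $w_1$ of total weight at most $S$. In each round $i\ge 1$ the attacker, who may choose attacks adaptively, attacks a vertex $v_i\in V$, and the defender chooses amounts $m_{xy,i}\ge 0$ for all $x\in V$, $y\in N(x)$, with $\sum_{y\in N(x)}m_{xy,i}\le w_i(x)$, and sets $w_{i+1}(x)=w_i(x)-\sum_{y\in N(x)}m_{xy,i}+\sum_{y\in N(x)}m_{yx,i}$. It is required that $w_{i+1}$ be a fractional dominating function and $w_{i+1}(v_i)\ge 1$. If the defender can respond in this way to every infinite sequence of attacks, $G$ can be eternally $S$-fractionally dominated. $\gamma_f^\infty(G)$ is the infimum of all $S$ for which $G$ can be eternally $S$-fractionally dominated. *)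

theory Defs
  imports Complex_Main "Graph_Theory.Pair_Digraph"
begin

text \<open>
  A finite simple graph is a \<^locale>\<open>pair_graph\<close>: finite vertex set, symmetric and loop-free arc set;
  \<open>x\<close> and \<open>y\<close> are adjacent iff \<open>(x, y) \<in> parcs G\<close>.
\<close>

definition open_nbhd :: "'a pair_pre_digraph \<Rightarrow> 'a \<Rightarrow> 'a set" where
  "open_nbhd G v = {x. (v, x) \<in> parcs G}"

definition closed_nbhd :: "'a pair_pre_digraph \<Rightarrow> 'a \<Rightarrow> 'a set" where
  "closed_nbhd G v = insert v (open_nbhd G v)"

definition path_graph :: "nat \<Rightarrow> nat pair_pre_digraph" where
  "path_graph n =
     \<lparr>pverts = {..<n},
      parcs = {(i, j). i < n \<and> j < n \<and> (j = Suc i \<or> i = Suc j)}\<rparr>"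

definition strong_product ::
    "'a pair_pre_digraph \<Rightarrow> 'b pair_pre_digraph \<Rightarrow> ('a \<times> 'b) pair_pre_digraph"
    (infixr "\<boxtimes>" 70) where
  "G \<boxtimes> H =
     \<lparr>pverts = pverts G \<times> pverts H,
      parcs = {((a, b), (a', b')).
        a \<in> pverts G \<and> b \<in> pverts H \<and> a' \<in> pverts G \<and> b' \<in> pverts H \<and>
        (a, b) \<noteq> (a', b') \<and>
        (a = a' \<or> (a, a') \<in> parcs G) \<and>
        (b = b' \<or> (b, b') \<in> parcs H)}\<rparr>"

text \<open>Weights are total functions on the vertex type; values outside the vertex set are irrelevant.\<close>

definition frac_dominating :: "'a pair_pre_digraph \<Rightarrow> ('a \<Rightarrow> real) \<Rightarrow> bool" where
  "frac_dominating G w \<longleftrightarrow>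
     (\<forall>v\<in>pverts G. w v \<ge> 0) \<and>
     (\<forall>v\<in>pverts G. (\<Sum>x\<in>closed_nbhd G v. w x) \<ge> 1)"

definition total_weight :: "'a pair_pre_digraph \<Rightarrow> ('a \<Rightarrow> real) \<Rightarrow> real" where
  "total_weight G w = (\<Sum>x\<in>pverts G. w x)"

text \<open>A move \<open>m\<close> sends the amount \<open>m x y\<close> from \<open>x\<close> to its neighbour \<open>y\<close>.\<close>

definition legal_move ::
    "'a pair_pre_digraph \<Rightarrow> ('a \<Rightarrow> real) \<Rightarrow> ('a \<Rightarrow> 'a \<Rightarrow> real) \<Rightarrow> bool" where
  "legal_move G w m \<longleftrightarrow>
     (\<forall>x\<in>pverts G. \<forall>y\<in>open_nbhd G x. m x y \<ge> 0) \<and>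
     (\<forall>x\<in>pverts G. (\<Sum>y\<in>open_nbhd G x. m x y) \<le> w x)"

definition apply_move ::
    "'a pair_pre_digraph \<Rightarrow> ('a \<Rightarrow> real) \<Rightarrow> ('a \<Rightarrow> 'a \<Rightarrow> real) \<Rightarrow> 'a \<Rightarrow> real" where
  "apply_move G w m =
     (\<lambda>x. w x - (\<Sum>y\<in>open_nbhd G x. m x y) + (\<Sum>y\<in>open_nbhd G x. m y x))"

text \<open>
  A defender strategy \<open>\<sigma>\<close> maps the nonempty list of attacks made so far, the current one last, to
  the move made in response. Since it sees no future attacks, quantifying over all attack sequences
  \<open>v\<close> after \<open>\<sigma>\<close> accounts for adaptive attackers. Rounds are counted from 0: \<open>weights G w\<^sub>1 \<sigma> v i\<close> is
  the weight function just before the attack on \<open>v i\<close>.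
\<close>

definition response :: "('a list \<Rightarrow> 'a \<Rightarrow> 'a \<Rightarrow> real) \<Rightarrow> (nat \<Rightarrow> 'a) \<Rightarrow> nat \<Rightarrow> 'a \<Rightarrow> 'a \<Rightarrow> real" where
  "response \<sigma> v i = \<sigma> (map v [0..<Suc i])"

primrec weights ::
    "'a pair_pre_digraph \<Rightarrow> ('a \<Rightarrow> real) \<Rightarrow> ('a list \<Rightarrow> 'a \<Rightarrow> 'a \<Rightarrow> real) \<Rightarrow> (nat \<Rightarrow> 'a) \<Rightarrow>
     nat \<Rightarrow> 'a \<Rightarrow> real" where
  "weights G w\<^sub>1 \<sigma> v 0 = w\<^sub>1"
| "weights G w\<^sub>1 \<sigma> v (Suc i) = apply_move G (weights G w\<^sub>1 \<sigma> v i) (response \<sigma> v i)"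

definition eternally_frac_dominated :: "'a pair_pre_digraph \<Rightarrow> real \<Rightarrow> bool" where
  "eternally_frac_dominated G S \<longleftrightarrow>
     (\<exists>w\<^sub>1 \<sigma>. frac_dominating G w\<^sub>1 \<and> total_weight G w\<^sub>1 \<le> S \<and>
       (\<forall>v. (\<forall>i. v i \<in> pverts G) \<longrightarrow>
         (\<forall>i. legal_move G (weights G w\<^sub>1 \<sigma> v i) (response \<sigma> v i) \<and>
              frac_dominating G (weights G w\<^sub>1 \<sigma> v (Suc i)) \<and>
              weights G w\<^sub>1 \<sigma> v (Suc i) (v i) \<ge> 1)))"

text \<open>
  For finite simple graphs the set below is nonempty and bounded below by 0 (proved below), so this
  real infimum is the genuine one.
\<close>

definition frac_eternal_domination_number :: "'a pair_pre_digraph \<Rightarrow> real" ("\<gamma>\<^sub>f\<^sup>\<infinity>") where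
  "\<gamma>\<^sub>f\<^sup>\<infinity> G = Inf {S. eternally_frac_dominated G S}"

lemma pair_graph_path_graph: "pair_graph (path_graph n)"
proof -
  have "finite {(i, j). i < n \<and> j < n \<and> (j = Suc i \<or> i = Suc j)}"
    by (rule finite_subset[of _ "{..<n} \<times> {..<n}"]) auto
  then show ?thesis
    by unfold_locales (auto simp: path_graph_def symmetric_def sym_def)
qed

lemma pair_graph_strong_product:
  assumes "pair_graph G" "pair_graph H"
  shows "pair_graph (G \<boxtimes> H)"
proof -
  interpret G: pair_graph G by fact
  interpret H: pair_graph H by fact
  have "finite (pverts (G \<boxtimes> H))"
    by (simp add: strong_product_def G.pair_finite_verts H.pair_finite_verts)
  moreover have "finite (parcs (G \<boxtimes> H))"
    by (rule finite_subset[of _ "(pverts G \<times> pverts H) \<times> (pverts G \<times> pverts H)"])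
      (auto simp: strong_product_def G.pair_finite_verts H.pair_finite_verts)
  moreover have "(x, y) \<in> parcs G \<Longrightarrow> (y, x) \<in> parcs G" for x y
    using G.pair_sym_arcs by (auto simp: symmetric_def dest: symD)
  moreover have "(x, y) \<in> parcs H \<Longrightarrow> (y, x) \<in> parcs H" for x y
    using H.pair_sym_arcs by (auto simp: symmetric_def dest: symD)
  ultimately show ?thesis
    by unfold_locales (auto simp: strong_product_def symmetric_def sym_def)
qed

lemma eternally_frac_dominated_nonneg:
  assumes "eternally_frac_dominated G S"
  shows "0 \<le> S"
proof -
  obtain w where w: "frac_dominating G w" "total_weight G w \<le> S"
    using assms by (auto simp: eternally_frac_dominated_def)
  then have "0 \<le> total_weight G w"
    by (auto simp: total_weight_def frac_dominating_def intro: sum_nonneg)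
  with w show ?thesis by simp
qed

lemma bdd_below_eternally_frac_dominated: "bdd_below {S. eternally_frac_dominated G S}"
  by (rule bdd_belowI[of _ 0]) (auto dest: eternally_frac_dominated_nonneg)

lemma eternally_frac_dominated_card:
  assumes "pair_graph G"
  shows "eternally_frac_dominated G (real (card (pverts G)))"
proof -
  interpret G: pair_graph G by fact
  define w :: "'a \<Rightarrow> real" where "w = (\<lambda>_. 1)"
  define \<sigma> :: "'a list \<Rightarrow> 'a \<Rightarrow> 'a \<Rightarrow> real" where "\<sigma> = (\<lambda>_ _ _. 0)"
  have fin: "finite (closed_nbhd G v)" for v
    by (rule finite_subset[of _ "insert v (pverts G)"])
      (auto simp: closed_nbhd_def open_nbhd_def G.pair_finite_verts dest: G.wellformed')
  have "1 \<le> card (closed_nbhd G v)" for v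
    using fin[of v] by (simp add: Suc_le_eq card_gt_0_iff closed_nbhd_def)
  then have dom: "frac_dominating G w"
    by (simp add: frac_dominating_def w_def)
  have wt: "weights G w \<sigma> v i = w" for v i
    by (induction i) (auto simp: apply_move_def response_def \<sigma>_def)
  have "legal_move G w (response \<sigma> v i)" for v i
    by (simp add: legal_move_def response_def \<sigma>_def w_def)
  moreover have "total_weight G w = real (card (pverts G))"
    by (simp add: total_weight_def w_def)
  ultimately show ?thesis
    unfolding eternally_frac_dominated_def
    by (intro exI[of _ w] exI[of _ \<sigma>])
      (simp add: wt dom del: weights.simps, simp add: w_def)
qed

lemma eternally_frac_dominated_nonempty:
  "pair_graph G \<Longrightarrow> {S. eternally_frac_dominated G S} \<noteq> {}"
  using eternally_frac_dominated_card by blast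

lemma frac_eternal_domination_number_path_0: "\<gamma>\<^sub>f\<^sup>\<infinity> (path_graph 0) = 0"
proof -
  have "eternally_frac_dominated (path_graph 0) S \<longleftrightarrow> 0 \<le> S" for S
    by (auto simp: eternally_frac_dominated_def frac_dominating_def total_weight_def path_graph_def)
  then have "{S. eternally_frac_dominated (path_graph 0) S} = {0..}"
    by auto
  then show ?thesis
    by (simp add: frac_eternal_domination_number_def)
qed

end

theory Submission
  imports Defs
begin

text \<open>
  The defender keeps weight 1 on every vertex of the rim (the boundary of the grid), weight
  \<open>1/9\<close> on every inner vertex, and an extra \<open>8/9\<close> on the vertex attacked last. An inner vertex has
  nine vertices in its closed neighbourhood, so this is dominating, and the attacked vertex carries
  at least 1. The rim has at most \<open>2(m + n)\<close> vertices, so the total is at most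
  \<open>mn/9 + 16(m + n)/9 + 8/9\<close>.

  To answer an attack on \<open>v\<close> when the extra weight lies on \<open>u\<close>, the defender has to transport \<open>8/9\<close>
  from \<open>u\<close> to \<open>v\<close>, possibly across the whole grid, in one round. All vertices can forward weight
  simultaneously: if a path from \<open>u\<close> to \<open>v\<close> is used to carry \<open>1/9\<close>, each of its vertices passes \<open>1/9\<close>
  of its own weight to the next one. So eight paths from \<open>u\<close> to \<open>v\<close> suffice, provided that every inner
  vertex other than \<open>u\<close> and \<open>v\<close> is on at most one of them; a rim vertex has weight 1 and may serve on
  all eight (\<open>move_along_paths\<close>, \<open>guard_weight_move\<close>).

  That such paths exist (\<open>eight_linked_board\<close>) is a matter of king's walks on a board. The rim is
  connected, so a path may go from \<open>u\<close> to the rim, along the rim, and from the rim to \<open>v\<close>. Up to the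
  symmetries of the board, \<open>v\<close> lies to the right of \<open>u\<close>, in direction between horizontal and diagonal.
  Unless \<open>u\<close> and \<open>v\<close> are adjacent, three parallel paths then run directly from \<open>u\<close> to \<open>v\<close>. Of the five
  other neighbours of \<open>u\<close>, the three in the column to its left go straight left to the rim and two go
  straight up or down; the same holds for \<open>v\<close> with right in place of left. Instead of paths, the
  proof gives a colouring of the board such that the inner part of the \<open>k\<close>-th path has colour \<open>k\<close>.
\<close>

section \<open>Strategies that remember only the last attack\<close>

text \<open>
  A strategy may depend on the whole history. If the weights are to be a function of the last attack
  alone, it is enough to find one legal move between any two of these states; \<open>u\<^sub>0\<close> plays the part of
  an attack before the first round.
\<close>

lemma eternally_frac_dominated_by_states:
  assumes "u\<^sub>0 \<in> pverts G" "total_weight G (w u\<^sub>0) \<le> S"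
    and dom: "\<And>u. u \<in> pverts G \<Longrightarrow> frac_dominating G (w u)"
    and guard: "\<And>u. u \<in> pverts G \<Longrightarrow> w u u \<ge> 1"
    and move: "\<And>u v. u \<in> pverts G \<Longrightarrow> v \<in> pverts G \<Longrightarrow>
      \<exists>m. legal_move G (w u) m \<and> apply_move G (w u) m = w v"
  shows "eternally_frac_dominated G S"
proof -
  obtain M where M: "\<And>u v. u \<in> pverts G \<Longrightarrow> v \<in> pverts G \<Longrightarrow>
      legal_move G (w u) (M u v) \<and> apply_move G (w u) (M u v) = w v"
    using move by metis
  define \<sigma> where "\<sigma> = (\<lambda>as. M (last (u\<^sub>0 # butlast as)) (last as))"
  define prev where "prev = (\<lambda>(v :: nat \<Rightarrow> 'a) i. case i of 0 \<Rightarrow> u\<^sub>0 | Suc j \<Rightarrow> v j)"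
  have resp: "response \<sigma> v i = M (prev v i) (v i)" for v i
    by (cases i) (simp_all add: response_def \<sigma>_def prev_def butlast_append)
  have prev: "prev v i \<in> pverts G" if "\<forall>i. v i \<in> pverts G" for v i
    using that assms(1) by (auto simp: prev_def split: nat.split)
  have wt: "weights G (w u\<^sub>0) \<sigma> v i = w (prev v i)" if v: "\<forall>i. v i \<in> pverts G" for v i
  proof (induction i)
    case (Suc i)
    then show ?case using M[OF prev[OF v], of "v i" i] v by (simp add: resp) (simp add: prev_def)
  qed (simp add: prev_def)
  show ?thesis
    unfolding eternally_frac_dominated_def
  proof (intro exI[of _ "w u\<^sub>0"] exI[of _ \<sigma>] conjI allI impI)
    fix v :: "nat \<Rightarrow> 'a" and i assume v: "\<forall>i. v i \<in> pverts G"
    show "legal_move G (weights G (w u\<^sub>0) \<sigma> v i) (response \<sigma> v i)"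
      using M[OF prev[OF v], of "v i" i] v by (simp add: wt[OF v] resp)
    show "frac_dominating G (weights G (w u\<^sub>0) \<sigma> v (Suc i))"
      unfolding wt[OF v] by (rule dom[OF prev[OF v]])
    show "1 \<le> weights G (w u\<^sub>0) \<sigma> v (Suc i) (v i)"
      unfolding wt[OF v] using guard v by (simp add: prev_def)
  qed (use assms in auto)
qed

section \<open>Moving weight along a family of paths\<close>

fun path_flow :: "'a list \<Rightarrow> 'a \<Rightarrow> 'a \<Rightarrow> real" where
  "path_flow (a # b # p) x y = of_bool (x = a \<and> y = b) + path_flow (b # p) x y"
| "path_flow _ x y = 0"

lemma path_flow_nonneg: "path_flow p x y \<ge> 0"
  by (induction p x y rule: path_flow.induct) auto

lemma finite_open_nbhd:
  assumes "pair_graph G"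
  shows "finite (open_nbhd G x)"
proof -
  interpret pair_graph G by fact
  show ?thesis
    by (rule finite_subset[OF _ pair_finite_verts]) (auto simp: open_nbhd_def dest: wellformed')
qed

lemma open_nbhd_sym:
  assumes "pair_graph G"
  shows "y \<in> open_nbhd G x \<longleftrightarrow> x \<in> open_nbhd G y"
proof -
  interpret pair_graph G by fact
  show ?thesis
    using pair_sym_arcs by (auto simp: open_nbhd_def symmetric_def dest: symD)
qed

text \<open>
  A vertex sends weight once for every occurrence on the path except at its end, and receives weight
  once for every occurrence except at its start. Counting occurrences makes this true for walks with
  repetitions too.
\<close>

lemma path_flow_out:
  assumes "pair_graph G" "successively (\<lambda>x y. y \<in> open_nbhd G x) p"
  shows "(\<Sum>y\<in>open_nbhd G x. path_flow p x y) = real (count_list (butlast p) x)"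
  using assms(2)
proof (induction p rule: induct_list012)
  case (3 a b p)
  have "(\<Sum>y\<in>open_nbhd G x. of_bool (x = a \<and> y = b)) = (of_bool (x = a) :: real)"
  proof (cases "x = a")
    case True
    then show ?thesis using 3(3) finite_open_nbhd[OF assms(1)]
      by (simp add: of_bool_def)
  qed simp
  then show ?case using 3 by (simp add: sum.distrib)
qed auto

lemma path_flow_in:
  assumes "pair_graph G" "successively (\<lambda>x y. y \<in> open_nbhd G x) p"
  shows "(\<Sum>y\<in>open_nbhd G x. path_flow p y x) = real (count_list (tl p) x)"
  using assms(2)
proof (induction p rule: induct_list012)
  case (3 a b p)
  have "(\<Sum>y\<in>open_nbhd G x. of_bool (y = a \<and> x = b)) = (of_bool (x = b) :: real)"
  proof (cases "x = b")
    case True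
    then show ?thesis using 3(3) finite_open_nbhd[OF assms(1)] open_nbhd_sym[OF assms(1)]
      by (simp add: of_bool_def)
  qed simp
  then show ?case using 3 by (simp add: sum.distrib)
qed auto

lemma count_list_butlast_tl:
  assumes "p \<noteq> []"
  shows "real (count_list (butlast p) x) + of_bool (x = last p)
    = real (count_list (tl p) x) + of_bool (x = hd p)"
proof -
  have "count_list (butlast p @ [last p]) x = count_list (hd p # tl p) x"
    using assms by simp
  then show ?thesis
    unfolding count_list_append by (auto split: if_splits)
qed

text \<open>
  All paths are used simultaneously, each carrying \<open>\<epsilon>\<close>. The intermediate vertices receive what they
  send, so only the weights of \<open>u\<close> and \<open>v\<close> change. Legality asks that a vertex own beforehand all that
  it sends, which is the capacity assumption.
\<close>

lemma move_along_paths: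
  fixes p :: "'k \<Rightarrow> 'a list"
  assumes G: "pair_graph G" and "finite K" "\<epsilon> \<ge> 0"
    and p: "\<And>k. k \<in> K \<Longrightarrow> p k \<noteq> []" "\<And>k. k \<in> K \<Longrightarrow> hd (p k) = u" "\<And>k. k \<in> K \<Longrightarrow> last (p k) = v"
      "\<And>k. k \<in> K \<Longrightarrow> successively (\<lambda>x y. y \<in> open_nbhd G x) (p k)"
    and capacity: "\<And>x. x \<in> pverts G \<Longrightarrow> \<epsilon> * (\<Sum>k\<in>K. real (count_list (butlast (p k)) x)) \<le> w x"
  shows "\<exists>m. legal_move G w m \<and> apply_move G w m =
    (\<lambda>x. w x - \<epsilon> * card K * of_bool (x = u) + \<epsilon> * card K * of_bool (x = v))"
proof (intro exI conjI)
  let ?m = "\<lambda>x y. \<epsilon> * (\<Sum>k\<in>K. path_flow (p k) x y)"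
  have out: "(\<Sum>y\<in>open_nbhd G x. ?m x y) = \<epsilon> * (\<Sum>k\<in>K. real (count_list (butlast (p k)) x))" for x
    by (subst sum_distrib_left[symmetric], subst sum.swap) (simp add: path_flow_out[OF G p(4)])
  have inn: "(\<Sum>y\<in>open_nbhd G x. ?m y x) = \<epsilon> * (\<Sum>k\<in>K. real (count_list (tl (p k)) x))" for x
    by (subst sum_distrib_left[symmetric], subst sum.swap) (simp add: path_flow_in[OF G p(4)])
  show "legal_move G w ?m"
    unfolding legal_move_def out
    using capacity \<open>\<epsilon> \<ge> 0\<close> by (auto intro!: mult_nonneg_nonneg sum_nonneg path_flow_nonneg)
  show "apply_move G w ?m =
    (\<lambda>x. w x - \<epsilon> * card K * of_bool (x = u) + \<epsilon> * card K * of_bool (x = v))"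
  proof
    fix x
    have "(\<Sum>k\<in>K. real (count_list (butlast (p k)) x) + of_bool (x = v))
      = (\<Sum>k\<in>K. real (count_list (tl (p k)) x) + of_bool (x = u))"
      by (rule sum.cong) (use count_list_butlast_tl[OF p(1), of _ x] p(2,3) in auto)
    then have "(\<Sum>k\<in>K. real (count_list (butlast (p k)) x)) + card K * of_bool (x = v)
      = (\<Sum>k\<in>K. real (count_list (tl (p k)) x)) + card K * of_bool (x = u)"
      by (simp add: sum.distrib)
    then have "\<epsilon> * ((\<Sum>k\<in>K. real (count_list (butlast (p k)) x)) + card K * of_bool (x = v))
      = \<epsilon> * ((\<Sum>k\<in>K. real (count_list (tl (p k)) x)) + card K * of_bool (x = u))"
      by simp
    then show "apply_move G w ?m x = w x - \<epsilon> * card K * of_bool (x = u) + \<epsilon> * card K * of_bool (x = v)"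
      unfolding apply_move_def out inn by (simp add: algebra_simps)
  qed
qed

lemma distinct_count_list: "distinct xs \<Longrightarrow> x \<in> set xs \<Longrightarrow> count_list xs x = 1"
  by (induction xs) auto

text \<open>
  A shortcut argument: if a first step leads back to a vertex of the path, the part of the path before
  that vertex is dropped. Distinctness is what bounds the load that a path puts on a vertex.
\<close>

lemma rtrancl_distinct_path:
  assumes "(x, y) \<in> r\<^sup>*" "r \<subseteq> S \<times> S" "x \<in> S"
  shows "\<exists>p. p \<noteq> [] \<and> hd p = x \<and> last p = y \<and> distinct p \<and> set p \<subseteq> S
    \<and> successively (\<lambda>a b. (a, b) \<in> r) p"
  using assms(1,3)
proof (induction rule: converse_rtrancl_induct)
  case base
  then show ?case by (intro exI[of _ "[y]"]) auto
next
  case (step x z)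
  then obtain p where p: "p \<noteq> []" "hd p = z" "last p = y" "distinct p" "set p \<subseteq> S"
    "successively (\<lambda>a b. (a, b) \<in> r) p"
    using assms(2) by blast
  show ?case
  proof (cases "x \<in> set p")
    case True
    then obtain ys zs where "p = ys @ x # zs" by (meson split_list)
    then show ?thesis
      using p by (intro exI[of _ "x # zs"]) (auto simp: successively_append_iff)
  next
    case False
    then show ?thesis
      using p step by (intro exI[of _ "x # p"]) (auto simp: successively_Cons)
  qed
qed

section \<open>Walks of a king on a rectangular board\<close>

text \<open>
  Squares are equal or adjacent in the strong product of paths. Including equality lets the walks below
  stand still, which saves case distinctions.
\<close>

definition king :: "nat \<times> nat \<Rightarrow> nat \<times> nat \<Rightarrow> bool" where
  "king = (\<lambda>(a, b) (c, d). a \<le> c + 1 \<and> c \<le> a + 1 \<and> b \<le> d + 1 \<and> d \<le> b + 1)"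

definition joined :: "(nat \<times> nat) set \<Rightarrow> nat \<times> nat \<Rightarrow> nat \<times> nat \<Rightarrow> bool" where
  "joined S x y \<longleftrightarrow> (x, y) \<in> {(x, y). x \<in> S \<and> y \<in> S \<and> king x y}\<^sup>*"

lemma joined_refl [simp]: "joined S x x"
  by (simp add: joined_def)

lemma joined_trans [trans]: "joined S x y \<Longrightarrow> joined S y z \<Longrightarrow> joined S x z"
  unfolding joined_def by (rule rtrancl_trans)

lemma joined_sym: "joined S x y \<Longrightarrow> joined S y x"
  unfolding joined_def
  by (rule symD[OF sym_rtrancl]) (auto simp: sym_def king_def)

lemma joined_king: "x \<in> S \<Longrightarrow> y \<in> S \<Longrightarrow> king x y \<Longrightarrow> joined S x y"
  unfolding joined_def by blast

lemma joined_mono: "joined S x y \<Longrightarrow> S \<subseteq> T \<Longrightarrow> joined T x y"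
  unfolding joined_def by (erule rtrancl_mono[THEN subsetD, rotated]) auto

lemma joined_image:
  assumes "joined S x y" and "\<And>x y. x \<in> S \<Longrightarrow> y \<in> S \<Longrightarrow> king x y \<Longrightarrow> king (f x) (f y)" and "f ` S \<subseteq> T"
  shows "joined T (f x) (f y)"
  using assms(1) unfolding joined_def
proof (induction rule: rtrancl_induct)
  case (step y z)
  then have "joined T (f y) (f z)"
    using assms(2,3) by (intro joined_king) auto
  with step.IH show ?case by (simp add: joined_def)
qed simp

text \<open>
  All walks in the colourings below are, up to a few end steps, graphs of functions on an interval of
  columns or the transposes of such graphs.
\<close>

lemma joined_graph:
  fixes h :: "nat \<Rightarrow> nat"
  assumes "x\<^sub>1 \<le> x\<^sub>2" and S: "\<And>x. x\<^sub>1 \<le> x \<Longrightarrow> x \<le> x\<^sub>2 \<Longrightarrow> (x, h x) \<in> S"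
    and h: "\<And>x. x\<^sub>1 \<le> x \<Longrightarrow> x < x\<^sub>2 \<Longrightarrow> h x \<le> h (Suc x) + 1 \<and> h (Suc x) \<le> h x + 1"
  shows "joined S (x\<^sub>1, h x\<^sub>1) (x\<^sub>2, h x\<^sub>2)"
  using assms
proof (induction x\<^sub>2 rule: dec_induct)
  case (step x)
  have "joined S (x\<^sub>1, h x\<^sub>1) (x, h x)"
    using step by simp
  also have "joined S (x, h x) (Suc x, h (Suc x))"
    using step(1) step.prems(2)[of x] by (intro joined_king step.prems(1)) (auto simp: king_def)
  finally show ?case .
qed simp

lemma joined_horizontal:
  assumes "x\<^sub>1 \<le> x\<^sub>2" "\<And>x. x\<^sub>1 \<le> x \<Longrightarrow> x \<le> x\<^sub>2 \<Longrightarrow> (x, y) \<in> S"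
  shows "joined S (x\<^sub>1, y) (x\<^sub>2, y)"
  using joined_graph[of x\<^sub>1 x\<^sub>2 "\<lambda>_. y" S] assms by auto

lemma joined_vertical:
  assumes "y\<^sub>1 \<le> y\<^sub>2" "\<And>y. y\<^sub>1 \<le> y \<Longrightarrow> y \<le> y\<^sub>2 \<Longrightarrow> (x, y) \<in> S"
  shows "joined S (x, y\<^sub>1) (x, y\<^sub>2)"
proof -
  have "joined (prod.swap ` S) (y\<^sub>1, x) (y\<^sub>2, x)"
    using assms by (intro joined_horizontal) force+
  then have "joined S (prod.swap (y\<^sub>1, x)) (prod.swap (y\<^sub>2, x))"
    by (rule joined_image) (auto simp: king_def)
  then show ?thesis by simp
qed

definition board :: "nat \<Rightarrow> nat \<Rightarrow> (nat \<times> nat) set" where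
  "board n m = {..<n} \<times> {..<m}"

definition rim :: "nat \<Rightarrow> nat \<Rightarrow> (nat \<times> nat) set" where
  "rim n m = {(x, y) \<in> board n m. x = 0 \<or> y = 0 \<or> Suc x = n \<or> Suc y = m}"

lemma joined_rim_origin:
  assumes "z \<in> rim n m"
  shows "joined (rim n m) z (0, 0)"
proof -
  obtain x y where z: "z = (x, y)" by (cases z)
  have xy: "x < n" "y < m" using assms by (auto simp: z rim_def board_def)
  consider "x = 0 \<or> Suc x = n" | "y = 0 \<or> Suc y = m"
    using assms by (auto simp: z rim_def)
  then show ?thesis
  proof cases
    case 1
    have "joined (rim n m) (x, 0) (x, y)"
      using 1 xy by (intro joined_vertical) (auto simp: rim_def board_def)
    moreover have "joined (rim n m) (0, 0) (x, 0)"
      using xy by (intro joined_horizontal) (auto simp: rim_def board_def)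
    ultimately show ?thesis unfolding z by (blast intro: joined_sym joined_trans)
  next
    case 2
    have "joined (rim n m) (0, y) (x, y)"
      using 2 xy by (intro joined_horizontal) (auto simp: rim_def board_def)
    moreover have "joined (rim n m) (0, 0) (0, y)"
      using xy by (intro joined_vertical) (auto simp: rim_def board_def)
    ultimately show ?thesis unfolding z by (blast intro: joined_sym joined_trans)
  qed
qed

definition reaches_rim :: "nat \<Rightarrow> nat \<Rightarrow> (nat \<times> nat) set \<Rightarrow> nat \<times> nat \<Rightarrow> bool" where
  "reaches_rim n m S u \<longleftrightarrow> (\<exists>z\<in>rim n m. joined S u z)"

lemma reaches_rim_rim: "u \<in> rim n m \<Longrightarrow> reaches_rim n m S u"
  unfolding reaches_rim_def using joined_refl by blast

text \<open>
  Because the rim is connected, it suffices to lead both ends to the rim, wherever they meet it.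
\<close>

lemma joined_via_rim:
  assumes "reaches_rim n m S u" "reaches_rim n m S v" "rim n m \<subseteq> S"
  shows "joined S u v"
  using assms unfolding reaches_rim_def
  by (meson joined_sym joined_trans joined_mono joined_rim_origin)

text \<open>
  Escape along a straight ray that starts in one of the three squares next to \<open>(a, b)\<close> on the given
  side. If \<open>(a, b)\<close> is close to the rim, the ray may already run inside it.
\<close>

lemma reaches_rim_left:
  assumes "(a, b) \<in> S" "(a, b) \<in> board n m" "0 < a" "r < m" "king (a, b) (a, r)"
    and "\<And>x. x < a \<Longrightarrow> (x, r) \<in> S"
  shows "reaches_rim n m S (a, b)"
proof -
  have "joined S (a, b) (a - 1, r)"
    using assms by (intro joined_king) (auto simp: king_def)
  also have "joined S (a - 1, r) (0, r)"
    using assms by (intro joined_sym[OF joined_horizontal]) auto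
  finally show ?thesis
    using assms unfolding reaches_rim_def by (intro bexI[of _ "(0, r)"]) (auto simp: rim_def board_def)
qed

lemma reaches_rim_right:
  assumes "(a, b) \<in> S" "Suc a < n" "r < m" "king (a, b) (a, r)"
    and "\<And>x. a < x \<Longrightarrow> x < n \<Longrightarrow> (x, r) \<in> S"
  shows "reaches_rim n m S (a, b)"
proof -
  have "joined S (a, b) (Suc a, r)"
    using assms by (intro joined_king) (auto simp: king_def)
  also have "joined S (Suc a, r) (n - 1, r)"
    using assms by (intro joined_horizontal) auto
  finally show ?thesis
    using assms unfolding reaches_rim_def by (intro bexI[of _ "(n - 1, r)"]) (auto simp: rim_def board_def)
qed

lemma reaches_rim_down:
  assumes "(a, b) \<in> S" "(a, b) \<in> board n m" "0 < b" "r < n" "king (a, b) (r, b)"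
    and "\<And>y. y < b \<Longrightarrow> (r, y) \<in> S"
  shows "reaches_rim n m S (a, b)"
proof -
  have "joined S (a, b) (r, b - 1)"
    using assms by (intro joined_king) (auto simp: king_def)
  also have "joined S (r, b - 1) (r, 0)"
    using assms by (intro joined_sym[OF joined_vertical]) auto
  finally show ?thesis
    using assms unfolding reaches_rim_def by (intro bexI[of _ "(r, 0)"]) (auto simp: rim_def board_def)
qed

lemma reaches_rim_up:
  assumes "(a, b) \<in> S" "Suc b < m" "r < n" "king (a, b) (r, b)"
    and "\<And>y. b < y \<Longrightarrow> y < m \<Longrightarrow> (r, y) \<in> S"
  shows "reaches_rim n m S (a, b)"
proof -
  have "joined S (a, b) (r, Suc b)"
    using assms by (intro joined_king) (auto simp: king_def)
  also have "joined S (r, Suc b) (r, m - 1)"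
    using assms by (intro joined_vertical) auto
  finally show ?thesis
    using assms unfolding reaches_rim_def by (intro bexI[of _ "(r, m - 1)"]) (auto simp: rim_def board_def)
qed

section \<open>Eight corridors between two squares\<close>

definition corridor ::
    "nat \<Rightarrow> nat \<Rightarrow> nat \<times> nat \<Rightarrow> nat \<times> nat \<Rightarrow> (nat \<times> nat \<Rightarrow> nat) \<Rightarrow> nat \<Rightarrow> (nat \<times> nat) set" where
  "corridor n m u v c k = {x \<in> board n m. x \<in> rim n m \<or> x = u \<or> x = v \<or> c x = k}"

text \<open>
  With a colouring, the eight corridors are automatically disjoint apart from the rim and the two ends,
  so only their connectedness has to be proved.
\<close>

definition eight_linked :: "nat \<Rightarrow> nat \<Rightarrow> nat \<times> nat \<Rightarrow> nat \<times> nat \<Rightarrow> bool" where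
  "eight_linked n m u v \<longleftrightarrow> (\<exists>c. \<forall>k<8. joined (corridor n m u v c k) u v)"

lemma rim_subset_corridor: "rim n m \<subseteq> corridor n m u v c k"
  by (auto simp: corridor_def rim_def)

lemma eight_linked_sym: "eight_linked n m u v \<Longrightarrow> eight_linked n m v u"
proof -
  have "corridor n m u v c k = corridor n m v u c k" for c k by (auto simp: corridor_def)
  then show "eight_linked n m u v \<Longrightarrow> eight_linked n m v u"
    unfolding eight_linked_def by (metis joined_sym)
qed

lemma eight_linked_isomorphism:
  assumes "eight_linked n m u v"
    and f: "f ` board n m \<subseteq> board n' m'" "f ` rim n m \<subseteq> rim n' m'"
      "\<And>x y. x \<in> board n m \<Longrightarrow> y \<in> board n m \<Longrightarrow> king x y \<Longrightarrow> king (f x) (f y)"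
    and g: "\<And>x. x \<in> board n m \<Longrightarrow> g (f x) = x"
  shows "eight_linked n' m' (f u) (f v)"
proof -
  obtain c where c: "\<And>k. k < 8 \<Longrightarrow> joined (corridor n m u v c k) u v"
    using assms(1) by (auto simp: eight_linked_def)
  have "joined (corridor n' m' (f u) (f v) (c \<circ> g) k) (f u) (f v)" if "k < 8" for k
    using c[OF that]
  proof (rule joined_image)
    show "f ` corridor n m u v c k \<subseteq> corridor n' m' (f u) (f v) (c \<circ> g) k"
      using f(1,2) g by (auto simp: corridor_def)
  qed (use f(3) in \<open>auto simp: corridor_def\<close>)
  then show ?thesis unfolding eight_linked_def by blast
qed

lemma eight_linked_transpose:
  assumes "eight_linked m n (b, a) (d, c)"
  shows "eight_linked n m (a, b) (c, d)"
proof -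
  have "eight_linked n m (prod.swap (b, a)) (prod.swap (d, c))"
    by (rule eight_linked_isomorphism[OF assms, where g = prod.swap])
      (auto simp: board_def rim_def king_def)
  then show ?thesis by simp
qed

lemma eight_linked_flip:
  assumes "eight_linked n m (a, m - 1 - b) (c, m - 1 - d)" "b < m" "d < m"
  shows "eight_linked n m (a, b) (c, d)"
proof -
  have "eight_linked n m ((\<lambda>(x, y). (x, m - 1 - y)) (a, m - 1 - b))
     ((\<lambda>(x, y). (x, m - 1 - y)) (c, m - 1 - d))"
    by (rule eight_linked_isomorphism[OF assms(1), where g = "\<lambda>(x, y). (x, m - 1 - y)"])
      (auto simp: board_def rim_def king_def)
  then show ?thesis using assms(2,3) by simp
qed

text \<open>
  Vertices other than the ends have limited capacity, edges do not: if \<open>u\<close> and \<open>v\<close> are adjacent, all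
  eight paths may be the edge between them.
\<close>

lemma eight_linked_king:
  assumes "u \<in> board n m" "v \<in> board n m" "king u v"
  shows "eight_linked n m u v"
  unfolding eight_linked_def
  using assms by (intro exI[of _ "\<lambda>_. 0"] allI impI joined_king) (auto simp: corridor_def)

lemma all_less_8: "(\<forall>k<8. P k) \<longleftrightarrow> P 0 \<and> P 1 \<and> P 2 \<and> P 3 \<and> P 4 \<and> P 5 \<and> P 6 \<and> P (7::nat)"
  by (simp add: numeral_eq_Suc All_less_Suc conj_ac)

text \<open>
  If \<open>v\<close> is on the rim, the eight neighbours of \<open>u\<close> escape in straight lines: three to the left, three
  to the right, one down and one up.
\<close>

lemma eight_linked_rim:
  assumes "u \<in> board n m" "v \<in> rim n m"
  shows "eight_linked n m u v"
proof (cases "u \<in> rim n m")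
  case True
  then have "joined (corridor n m u v c k) u v" for c k
    using assms rim_subset_corridor
    by (intro joined_via_rim[where n = n and m = m]) (auto intro: reaches_rim_rim)
  then show ?thesis by (auto simp: eight_linked_def)
next
  case False
  obtain a b where u: "u = (a, b)" by (cases u)
  have ab: "0 < a" "Suc a < n" "0 < b" "Suc b < m"
    using False assms(1) by (auto simp: u rim_def board_def)
  define c where "c = (\<lambda>(x, y). if x < a then y + 1 - b else if x > a then 3 + (y + 1 - b)
     else if y < b then 6 else (7::nat))"
  let ?S = "corridor n m u v c"
  have S: "u \<in> ?S k" for k using assms(1) by (auto simp: corridor_def)
  have "\<forall>k<8. reaches_rim n m (?S k) u"
    unfolding all_less_8
  proof (intro conjI)
    show "reaches_rim n m (?S 0) u" unfolding u
      by (rule reaches_rim_left[where r = "b - 1"]) (use ab in \<open>auto simp: u corridor_def board_def king_def c_def\<close>)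
    show "reaches_rim n m (?S 1) u" unfolding u
      by (rule reaches_rim_left[where r = b]) (use ab in \<open>auto simp: u corridor_def board_def king_def c_def\<close>)
    show "reaches_rim n m (?S 2) u" unfolding u
      by (rule reaches_rim_left[where r = "b + 1"]) (use ab in \<open>auto simp: u corridor_def board_def king_def c_def\<close>)
    show "reaches_rim n m (?S 3) u" unfolding u
      by (rule reaches_rim_right[where r = "b - 1"]) (use ab in \<open>auto simp: u corridor_def board_def king_def c_def\<close>)
    show "reaches_rim n m (?S 4) u" unfolding u
      by (rule reaches_rim_right[where r = b]) (use ab in \<open>auto simp: u corridor_def board_def king_def c_def\<close>)
    show "reaches_rim n m (?S 5) u" unfolding u
      by (rule reaches_rim_right[where r = "b + 1"]) (use ab in \<open>auto simp: u corridor_def board_def king_def c_def\<close>)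
    show "reaches_rim n m (?S 6) u" unfolding u
      by (rule reaches_rim_down[where r = a]) (use ab in \<open>auto simp: u corridor_def board_def king_def c_def\<close>)
    show "reaches_rim n m (?S 7) u" unfolding u
      by (rule reaches_rim_up[where r = a]) (use ab in \<open>auto simp: u corridor_def board_def king_def c_def\<close>)
  qed
  moreover have "reaches_rim n m (?S k) v" for k
    using assms(2) by (rule reaches_rim_rim)
  ultimately show ?thesis
    unfolding eight_linked_def using joined_via_rim[OF _ _ rim_subset_corridor] by blast
qed


text \<open>
  The frame common to all remaining positions. Corridors 0, 1, 2 are the three rows around \<open>u = (a, b)\<close>
  to the left of \<open>u\<close> and the three rows around \<open>v = (a', b')\<close> to the right of \<open>v\<close>, colour \<open>j\<close> being
  given to rows \<open>b - 1 + j\<close> and \<open>b' - 1 + j\<close>. Corridors 3, 4, 5 connect \<open>u\<close> to \<open>v\<close> directly, and 6, 7 reach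
  the rim from \<open>u\<close> and from \<open>v\<close> in the columns from \<open>a\<close> to \<open>a'\<close>.
\<close>

lemma eight_linkedI:
  fixes n m a b a' b' :: nat and c :: "nat \<times> nat \<Rightarrow> nat"
  defines "S \<equiv> corridor n m (a, b) (a', b') c"
  assumes inner: "0 < a" "a \<le> a'" "Suc a' < n" "0 < b" "Suc b < m" "0 < b'" "Suc b' < m"
    and left: "\<And>x y. x < a \<Longrightarrow> c (x, y) = y + 1 - b"
    and right: "\<And>x y. a' < x \<Longrightarrow> c (x, y) = y + 1 - b'"
    and direct: "\<And>j. j < 3 \<Longrightarrow> joined (S (3 + j)) (a, b) (a', b')"
    and rim: "reaches_rim n m (S 6) (a, b)" "reaches_rim n m (S 7) (a, b)"
      "reaches_rim n m (S 6) (a', b')" "reaches_rim n m (S 7) (a', b')"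
  shows "eight_linked n m (a, b) (a', b')"
proof -
  have rim_S: "rim n m \<subseteq> S k" for k by (simp add: S_def rim_subset_corridor)
  have rows: "joined (S j) (a, b) (a', b')" if "j < 3" for j
  proof (rule joined_via_rim[OF _ _ rim_S])
    show "reaches_rim n m (S j) (a, b)"
      by (rule reaches_rim_left[where r = "b + j - 1"])
        (use inner left that in \<open>auto simp: S_def corridor_def board_def king_def\<close>)
    show "reaches_rim n m (S j) (a', b')"
      by (rule reaches_rim_right[where r = "b' + j - 1"])
        (use inner right that in \<open>auto simp: S_def corridor_def board_def king_def\<close>)
  qed
  have "\<forall>k<8. joined (S k) (a, b) (a', b')"
    unfolding all_less_8
    using rows[of 0] rows[of 1] rows[of 2] direct[of 0] direct[of 1] direct[of 2]
      joined_via_rim[OF rim(1,3) rim_S] joined_via_rim[OF rim(2,4) rim_S]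
    by simp
  then show ?thesis
    unfolding eight_linked_def S_def by blast
qed

text \<open>
  Three parallel paths lead from the column right of \<open>u\<close> to the column left of \<open>v\<close>. They have \<open>p - 2\<close>
  steps to climb \<open>q\<close> rows, hence \<open>q + 2 \<le> p\<close>; they climb first and then stay level. This leaves the
  columns of \<open>u\<close> and \<open>v\<close> free for the two vertical escapes.
\<close>

lemma eight_linked_shallow:
  assumes "0 < a" "Suc (a + p) < n" "0 < b" "Suc (b + q) < m" "q + 2 \<le> p"
  shows "eight_linked n m (a, b) (a + p, b + q)"
proof -
  define c where "c = (\<lambda>(x, y). if x < a then y + 1 - b else if x > a + p then y + 1 - (b + q)
     else if x = a then (if y < b then 6 else 7) else if x = a + p then (if y < b + q then 6 else 7)
     else 3 + (y + 1 - (b + min (x - a - 1) q)))"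
  let ?S = "corridor n m (a, b) (a + p, b + q) c"
  note S = corridor_def board_def king_def c_def
  show ?thesis
  proof (rule eight_linkedI[where c = c])
    show "joined (?S (3 + j)) (a, b) (a + p, b + q)" if j: "j < 3" for j
    proof -
      define h where "h = (\<lambda>x. b + j - 1 + min (x - a - 1) q)"
      have "joined (?S (3 + j)) (a, b) (a + 1, h (a + 1))"
        using assms j by (intro joined_king) (auto simp: S h_def)
      also have "joined (?S (3 + j)) (a + 1, h (a + 1)) (a + p - 1, h (a + p - 1))"
        using assms j by (intro joined_graph) (auto simp: S h_def)
      also have "joined (?S (3 + j)) (a + p - 1, h (a + p - 1)) (a + p, b + q)"
        using assms j by (intro joined_king) (auto simp: S h_def)
      finally show ?thesis .
    qed
    show "reaches_rim n m (?S 6) (a, b)"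
      by (rule reaches_rim_down[where r = a]) (use assms in \<open>auto simp: S\<close>)
    show "reaches_rim n m (?S 7) (a, b)"
      by (rule reaches_rim_up[where r = a]) (use assms in \<open>auto simp: S\<close>)
    show "reaches_rim n m (?S 6) (a + p, b + q)"
      by (rule reaches_rim_down[where r = "a + p"]) (use assms in \<open>auto simp: S\<close>)
    show "reaches_rim n m (?S 7) (a + p, b + q)"
      by (rule reaches_rim_up[where r = "a + p"]) (use assms in \<open>auto simp: S\<close>)
  qed (use assms in \<open>auto simp: c_def\<close>)
qed

text \<open>
  Here there is one step too few, so the three direct paths stay diagonal all the way and start in the
  neighbours above, diagonally above and to the right of \<open>u\<close>. The square above \<open>u\<close> is thus occupied, and
  \<open>u\<close> escapes downwards twice, in its own column and in the next. At \<open>v\<close> the direct paths arrive in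
  the column to its left, so \<open>v\<close> escapes up and down in its own column.
\<close>

lemma eight_linked_near_diagonal:
  assumes "0 < a" "Suc (a + p) < n" "0 < b" "Suc (b + q) < m" "p = q + 1" "2 \<le> p"
  shows "eight_linked n m (a, b) (a + p, b + q)"
proof -
  define c where "c = (\<lambda>(x, y). if x < a then y + 1 - b else if x > a + p then y + 1 - (b + q)
     else if x = a then (if y < b then 6 else 5) else if x = a + p then (if y < b + q then 6 else 7)
     else if y < b then 7 else 3 + (y + 1 - (b + (x - a))))"
  let ?S = "corridor n m (a, b) (a + p, b + q) c"
  note S = corridor_def board_def king_def c_def
  show ?thesis
  proof (rule eight_linkedI[where c = c])
    show "joined (?S (3 + j)) (a, b) (a + p, b + q)" if j: "j < 3" for j
    proof -
      \<comment> \<open>The highest path starts one column earlier, in the square above \<open>u\<close>; for the others the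
        first step of the chain stands still.\<close>
      define h where "h = (\<lambda>x. b + j + (x - a) - 1)"
      have "joined (?S (3 + j)) (a, b) (a, if j = 2 then b + 1 else b)"
        using assms j by (intro joined_king) (auto simp: S)
      also have "joined (?S (3 + j)) (a, if j = 2 then b + 1 else b) (a + 1, h (a + 1))"
        using assms j by (intro joined_king) (auto simp: S h_def)
      also have "joined (?S (3 + j)) (a + 1, h (a + 1)) (a + p - 1, h (a + p - 1))"
        using assms j by (intro joined_graph) (auto simp: S h_def)
      also have "joined (?S (3 + j)) (a + p - 1, h (a + p - 1)) (a + p, b + q)"
        using assms j by (intro joined_king) (auto simp: S h_def)
      finally show ?thesis .
    qed
    show "reaches_rim n m (?S 6) (a, b)"
      by (rule reaches_rim_down[where r = a]) (use assms in \<open>auto simp: S\<close>)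
    show "reaches_rim n m (?S 7) (a, b)"
      by (rule reaches_rim_down[where r = "a + 1"]) (use assms in \<open>auto simp: S\<close>)
    show "reaches_rim n m (?S 6) (a + p, b + q)"
      by (rule reaches_rim_down[where r = "a + p"]) (use assms in \<open>auto simp: S\<close>)
    show "reaches_rim n m (?S 7) (a + p, b + q)"
      by (rule reaches_rim_up[where r = "a + p"]) (use assms in \<open>auto simp: S\<close>)
  qed (use assms in \<open>auto simp: c_def\<close>)
qed

text \<open>
  The direct paths again start above, diagonally above and to the right of \<open>u\<close>, and now end to the left of,
  diagonally below and below \<open>v\<close>. So \<open>v\<close> escapes upwards twice, in its own column and in the previous one.
\<close>

lemma eight_linked_diagonal:
  assumes "0 < a" "Suc (a + p) < n" "0 < b" "Suc (b + p) < m" "2 \<le> p"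
  shows "eight_linked n m (a, b) (a + p, b + p)"
proof -
  define c where "c = (\<lambda>(x, y). if x < a then y + 1 - b else if x > a + p then y + 1 - (b + p)
     else if x = a then (if y < b then 6 else 5) else if x = a + p then (if y > b + p then 6 else 3)
     else if y < b \<or> y > b + p then 7 else 3 + (y + 1 - (b + (x - a))))"
  let ?S = "corridor n m (a, b) (a + p, b + p) c"
  note S = corridor_def board_def king_def c_def
  show ?thesis
  proof (rule eight_linkedI[where c = c])
    show "joined (?S (3 + j)) (a, b) (a + p, b + p)" if j: "j < 3" for j
    proof -
      \<comment> \<open>The highest path starts one column earlier, in the square above \<open>u\<close>; for the others the
        first step of the chain stands still.\<close>
      define h where "h = (\<lambda>x. b + j + (x - a) - 1)"
      have "joined (?S (3 + j)) (a, b) (a, if j = 2 then b + 1 else b)"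
        using assms j by (intro joined_king) (auto simp: S)
      also have "joined (?S (3 + j)) (a, if j = 2 then b + 1 else b) (a + 1, h (a + 1))"
        using assms j by (intro joined_king) (auto simp: S h_def)
      also have "joined (?S (3 + j)) (a + 1, h (a + 1)) (a + p - 1, h (a + p - 1))"
        using assms j by (intro joined_graph) (auto simp: S h_def)
      \<comment> \<open>Symmetrically, the lowest path needs one more square, the one below \<open>v\<close>.\<close>
      also have "joined (?S (3 + j)) (a + p - 1, h (a + p - 1)) (a + p, if j = 0 then b + p - 1 else b + p)"
        using assms j by (intro joined_king) (auto simp: S h_def)
      also have "joined (?S (3 + j)) (a + p, if j = 0 then b + p - 1 else b + p) (a + p, b + p)"
        using assms j by (intro joined_king) (auto simp: S)
      finally show ?thesis .
    qed
    show "reaches_rim n m (?S 6) (a, b)"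
      by (rule reaches_rim_down[where r = a]) (use assms in \<open>auto simp: S\<close>)
    show "reaches_rim n m (?S 7) (a, b)"
      by (rule reaches_rim_down[where r = "a + 1"]) (use assms in \<open>auto simp: S\<close>)
    show "reaches_rim n m (?S 6) (a + p, b + p)"
      by (rule reaches_rim_up[where r = "a + p"]) (use assms in \<open>auto simp: S\<close>)
    show "reaches_rim n m (?S 7) (a + p, b + p)"
      by (rule reaches_rim_up[where r = "a + p - 1"]) (use assms in \<open>auto simp: S\<close>)
  qed (use assms in \<open>auto simp: c_def\<close>)
qed

lemma eight_linked_octant:
  assumes "0 < a" "Suc (a + p) < n" "0 < b" "Suc (b + q) < m" "q \<le> p"
  shows "eight_linked n m (a, b) (a + p, b + q)"
proof -
  consider "p \<le> 1" | "2 \<le> p" "q + 2 \<le> p" | "2 \<le> p" "p = q + 1" | "2 \<le> p" "q = p"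
    using assms(5) by linarith
  then show ?thesis
  proof cases
    case 1
    then show ?thesis using assms by (intro eight_linked_king) (auto simp: board_def king_def)
  next
    case 2
    then show ?thesis using assms eight_linked_shallow by simp
  next
    case 3
    then show ?thesis using assms eight_linked_near_diagonal by simp
  next
    case 4
    then show ?thesis using assms eight_linked_diagonal by simp
  qed
qed

lemma eight_linked_quadrant:
  assumes "0 < a" "Suc (a + p) < n" "0 < b" "Suc (b + q) < m"
  shows "eight_linked n m (a, b) (a + p, b + q)"
proof (cases "q \<le> p")
  case True
  then show ?thesis using assms by (intro eight_linked_octant) auto
next
  case False
  then show ?thesis using assms by (intro eight_linked_transpose[OF eight_linked_octant]) auto
qed

lemma eight_linked_half:
  assumes "(a, b) \<in> board n m - rim n m" "(c, d) \<in> board n m - rim n m" "a \<le> c"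
  shows "eight_linked n m (a, b) (c, d)"
proof -
  have inner: "0 < a" "Suc c < n" "0 < b" "Suc b < m" "0 < d" "Suc d < m"
    using assms by (auto simp: board_def rim_def)
  show ?thesis
  proof (cases "b \<le> d")
    case True
    then show ?thesis
      using eight_linked_quadrant[of a "c - a" n b "d - b" m] inner assms(3) by simp
  next
    case False
    have "eight_linked n m (a, m - 1 - b) (c, m - 1 - d)"
      using eight_linked_quadrant[of a "c - a" n "m - 1 - b" "b - d" m] False inner assms(3) by simp
    then show ?thesis by (rule eight_linked_flip) (use inner False in auto)
  qed
qed

lemma eight_linked_board:
  assumes "u \<in> board n m" "v \<in> board n m"
  shows "eight_linked n m u v"
proof (cases "u \<in> rim n m \<or> v \<in> rim n m")
  case True
  then show ?thesis using assms eight_linked_rim eight_linked_sym by blast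
next
  case False
  obtain a b c d where uv: "u = (a, b)" "v = (c, d)" by (metis surj_pair)
  show ?thesis
  proof (cases "a \<le> c")
    case True
    then show ?thesis using assms False unfolding uv by (intro eight_linked_half) auto
  next
    case nle: False
    then show ?thesis using assms False unfolding uv
      by (intro eight_linked_sym[OF eight_linked_half]) auto
  qed
qed

section \<open>The strategy\<close>

lemma pverts_grid: "pverts (path_graph n \<boxtimes> path_graph m) = board n m"
  by (simp add: strong_product_def path_graph_def board_def)

lemma open_nbhd_grid:
  "open_nbhd (path_graph n \<boxtimes> path_graph m) x = {y. x \<in> board n m \<and> y \<in> board n m \<and> x \<noteq> y \<and> king x y}"
  by (auto simp: open_nbhd_def strong_product_def path_graph_def board_def king_def)

lemma pair_graph_grid: "pair_graph (path_graph n \<boxtimes> path_graph m)"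
  by (intro pair_graph_strong_product pair_graph_path_graph)

definition base_weight :: "nat \<Rightarrow> nat \<Rightarrow> nat \<times> nat \<Rightarrow> real" where
  "base_weight n m x = (if x \<in> rim n m then 1 else 1 / 9)"

definition guard_weight :: "nat \<Rightarrow> nat \<Rightarrow> nat \<times> nat \<Rightarrow> nat \<times> nat \<Rightarrow> real" where
  "guard_weight n m u x = base_weight n m x + 8 / 9 * of_bool (x = u)"

lemma guard_weight_ge: "1 / 9 \<le> guard_weight n m u x" "x \<in> rim n m \<Longrightarrow> 1 \<le> guard_weight n m u x"
  by (auto simp: guard_weight_def base_weight_def)

text \<open>
  An inner vertex sees a full three by three block of weights at least \<open>1/9\<close>; a rim vertex may see fewer
  vertices, but has weight 1 itself.
\<close>

lemma frac_dominating_guard_weight: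
  "frac_dominating (path_graph n \<boxtimes> path_graph m) (guard_weight n m u)"
  unfolding frac_dominating_def pverts_grid
proof (intro conjI ballI)
  let ?G = "path_graph n \<boxtimes> path_graph m"
  fix x
  show "0 \<le> guard_weight n m u x" using guard_weight_ge(1)[of n m u x] by simp
  assume x: "x \<in> board n m"
  have fin: "finite (closed_nbhd ?G x)"
    by (simp add: closed_nbhd_def finite_open_nbhd pair_graph_grid)
  have nonneg: "0 \<le> guard_weight n m u y" for y using guard_weight_ge(1)[of n m u y] by simp
  show "1 \<le> (\<Sum>y\<in>closed_nbhd ?G x. guard_weight n m u y)"
  proof (cases "x \<in> rim n m")
    case True
    have "guard_weight n m u x \<le> (\<Sum>y\<in>closed_nbhd ?G x. guard_weight n m u y)"
      by (rule member_le_sum) (use fin nonneg in \<open>auto simp: closed_nbhd_def\<close>)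
    with guard_weight_ge(2)[OF True, of u] show ?thesis by simp
  next
    case False
    obtain a b where ab: "x = (a, b)" by (cases x)
    have "{a - 1..a + 1} \<times> {b - 1..b + 1} \<subseteq> closed_nbhd ?G x"
      using x False by (auto simp: ab closed_nbhd_def open_nbhd_grid board_def rim_def king_def)
    moreover have "card ({a - 1..a + 1} \<times> {b - 1..b + 1}) = 9"
      using x False by (simp add: ab card_cartesian_product rim_def board_def)
    ultimately have "9 \<le> card (closed_nbhd ?G x)"
      using card_mono[OF fin] by metis
    then have "1 \<le> real (card (closed_nbhd ?G x)) * (1 / 9)" by simp
    also have "\<dots> \<le> (\<Sum>y\<in>closed_nbhd ?G x. guard_weight n m u y)"
      by (rule sum_bounded_below) (rule guard_weight_ge(1))
    finally show ?thesis .
  qed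
qed

lemma card_rim: "card (rim n m) \<le> 2 * (n + m)"
proof -
  have "rim n m \<subseteq> ({0, n - 1} \<times> {..<m}) \<union> ({..<n} \<times> {0, m - 1})"
    by (auto simp: rim_def board_def)
  then have "card (rim n m) \<le> card (({0, n - 1} \<times> {..<m}) \<union> ({..<n} \<times> {0, m - 1}))"
    by (intro card_mono) auto
  also have "\<dots> \<le> card {0, n - 1} * m + n * card {0, m - 1}"
    using card_Un_le[of "{0, n - 1} \<times> {..<m}" "{..<n} \<times> {0, m - 1}"]
    by (simp add: card_cartesian_product)
  also have "\<dots> \<le> 2 * m + n * 2"
    by (intro add_mono mult_mono) (auto simp: card_insert_if)
  finally show ?thesis by simp
qed

lemma total_weight_guard_weight:
  assumes "u \<in> board n m"
  shows "total_weight (path_graph n \<boxtimes> path_graph m) (guard_weight n m u)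
    \<le> real m * real n / 9 + 16 * (real m + real n) / 9 + 8 / 9"
proof -
  have fin: "finite (board n m)" by (simp add: board_def)
  have sub: "rim n m \<subseteq> board n m" by (auto simp: rim_def)
  have "total_weight (path_graph n \<boxtimes> path_graph m) (guard_weight n m u)
    = (\<Sum>x\<in>board n m. 1 / 9 + 8 / 9 * of_bool (x \<in> rim n m) + 8 / 9 * of_bool (x = u))"
    unfolding total_weight_def pverts_grid
    by (rule sum.cong) (auto simp: guard_weight_def base_weight_def)
  also have "\<dots> = real (card (board n m)) / 9 + 8 / 9 * real (card (rim n m)) + 8 / 9"
  proof -
    have "(\<Sum>x\<in>board n m. of_bool (x \<in> rim n m)) = real (card (rim n m))"
      "(\<Sum>x\<in>board n m. of_bool (x = u)) = (1 :: real)"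
      using fin sub assms by (simp_all add: of_bool_def sum.If_cases Int_absorb1)
    then show ?thesis
      by (simp only: sum.distrib sum_distrib_left[symmetric] sum_constant)
  qed
  also have "\<dots> \<le> real m * real n / 9 + 16 * (real m + real n) / 9 + 8 / 9"
    using of_nat_mono[OF card_rim[of n m], where 'a = real]
    by (simp add: board_def card_cartesian_product mult.commute[of "real n"] add_divide_distrib)
  finally show ?thesis .
qed

text \<open>
  Distinct paths are extracted from the corridors. Eight of them put a load of at most \<open>8/9\<close> on \<open>u\<close> and
  on rim vertices, which have weight at least 1. Any other vertex sends weight only along the path of its
  own colour, and \<open>v\<close>, the end of every path, sends nothing.
\<close>

lemma guard_weight_move:
  assumes u: "u \<in> board n m" and v: "v \<in> board n m"
  shows "\<exists>t. legal_move (path_graph n \<boxtimes> path_graph m) (guard_weight n m u) t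
    \<and> apply_move (path_graph n \<boxtimes> path_graph m) (guard_weight n m u) t = guard_weight n m v"
proof -
  let ?G = "path_graph n \<boxtimes> path_graph m"
  obtain c where c: "\<forall>k<8. joined (corridor n m u v c k) u v"
    using eight_linked_board[OF u v] by (auto simp: eight_linked_def)
  define C where "C = corridor n m u v c"
  define route where "route = (\<lambda>k q. q \<noteq> [] \<and> hd q = u \<and> last q = v \<and> distinct q \<and> set q \<subseteq> C k
    \<and> successively (\<lambda>x y. (x, y) \<in> {(x, y). x \<in> C k \<and> y \<in> C k \<and> king x y}) q)"
  have "\<exists>q. route k q" if "k \<in> {..<8}" for k
    unfolding route_def
  proof (rule rtrancl_distinct_path)
    show "(u, v) \<in> {(x, y). x \<in> C k \<and> y \<in> C k \<and> king x y}\<^sup>*"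
      using c that unfolding joined_def C_def by simp
    show "u \<in> C k" using u by (simp add: C_def corridor_def)
  qed auto
  then obtain p where "\<And>k. k \<in> {..<8} \<Longrightarrow> route k (p k)"
    by metis
  note p = this[unfolded route_def]
  have C_board: "C k \<subseteq> board n m" for k by (auto simp: C_def corridor_def)
  \<comment> \<open>Distinctness excludes steps that stand still, which are not edges of the graph.\<close>
  have succ: "successively (\<lambda>x y. y \<in> open_nbhd ?G x) (p k)" if k: "k \<in> {..<8}" for k
    unfolding successively_conv_nth
  proof (intro allI impI)
    fix i assume i: "Suc i < length (p k)"
    have "p k ! i \<noteq> p k ! Suc i"
      using p[OF k] i by (simp add: nth_eq_iff_index_eq)
    moreover have "p k ! i \<in> C k" "p k ! Suc i \<in> C k" "king (p k ! i) (p k ! Suc i)"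
      using p[OF k] i by (auto simp: successively_conv_nth)
    ultimately show "p k ! Suc i \<in> open_nbhd ?G (p k ! i)"
      using C_board by (auto simp: open_nbhd_grid)
  qed
  have count: "count_list (butlast (p k)) x \<le> of_bool (x \<noteq> v \<and> x \<in> C k)" if "k \<in> {..<8}" for k x
  proof -
    have "p k = butlast (p k) @ [v]"
      using p[OF that] append_butlast_last_id[of "p k"] by simp
    then have "distinct (butlast (p k) @ [v])"
      using p[OF that] by metis
    then have *: "distinct (butlast (p k))" "v \<notin> set (butlast (p k))"
      by auto
    show ?thesis
    proof (cases "x \<in> set (butlast (p k))")
      case True
      then have "x \<noteq> v" "x \<in> C k"
        using p[OF that] *(2) in_set_butlastD[of x "p k"] by auto
      then show ?thesis
        using *(1) True by (simp add: distinct_count_list)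
    qed simp
  qed
  have capacity: "1 / 9 * (\<Sum>k\<in>{..<8}. real (count_list (butlast (p k)) x)) \<le> guard_weight n m u x" for x
  proof -
    have "(\<Sum>k\<in>{..<8}. real (count_list (butlast (p k)) x)) \<le> (\<Sum>k\<in>{..<8}. of_bool (x \<noteq> v \<and> x \<in> C k))"
      by (intro sum_mono) (metis count of_nat_mono of_nat_of_bool)
    also have "\<dots> \<le> (if x \<in> rim n m \<or> x = u then 8 else 1)"
    proof (cases "x \<in> rim n m \<or> x = u")
      case True
      have "(\<Sum>k\<in>{..<8::nat}. of_bool (x \<noteq> v \<and> x \<in> C k)) \<le> (\<Sum>k\<in>{..<8::nat}. 1::real)"
        by (intro sum_mono) auto
      with True show ?thesis by simp
    next
      case False
      have "(\<Sum>k\<in>{..<8::nat}. of_bool (x \<noteq> v \<and> x \<in> C k)) \<le> (\<Sum>k\<in>{..<8::nat}. of_bool (k = c x) :: real)"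
        using False by (intro sum_mono) (auto simp: C_def corridor_def)
      also have "\<dots> \<le> 1" by (simp add: of_bool_def)
      finally show ?thesis using False by simp
    qed
    finally show ?thesis
      using guard_weight_ge(1)[of n m u x] guard_weight_ge(2)[of x n m u] by (auto simp: guard_weight_def base_weight_def split: if_splits)
  qed
  have "\<exists>t. legal_move ?G (guard_weight n m u) t \<and> apply_move ?G (guard_weight n m u) t =
    (\<lambda>x. guard_weight n m u x - 1 / 9 * card {..<8::nat} * of_bool (x = u)
      + 1 / 9 * card {..<8::nat} * of_bool (x = v))"
    by (rule move_along_paths[where p = p, OF pair_graph_grid]) (use p succ capacity in auto)
  moreover have "(\<lambda>x. guard_weight n m u x - 1 / 9 * card {..<8::nat} * of_bool (x = u)
      + 1 / 9 * card {..<8::nat} * of_bool (x = v)) = guard_weight n m v"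
    by (auto simp: guard_weight_def)
  ultimately show ?thesis by simp
qed

theorem theorem6p4:
  fixes m n :: nat
  shows "\<gamma>\<^sub>f\<^sup>\<infinity> (path_graph n \<boxtimes> path_graph m)
    \<le> real m * real n / 9 + 16 * (real m + real n) / 9 + 114 / 9"
proof -
  let ?G = "path_graph n \<boxtimes> path_graph m"
  have "eternally_frac_dominated ?G (real m * real n / 9 + 16 * (real m + real n) / 9 + 114 / 9)"
    if "n > 0" "m > 0"
  proof (rule eternally_frac_dominated_by_states[of "(0, 0)"])
    have origin: "(0, 0) \<in> board n m" using that by (simp add: board_def)
    then show "(0, 0) \<in> pverts ?G" by (simp add: pverts_grid)
    show "total_weight ?G (guard_weight n m (0, 0))
      \<le> real m * real n / 9 + 16 * (real m + real n) / 9 + 114 / 9"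
      using total_weight_guard_weight[OF origin] by simp
    show "1 \<le> guard_weight n m u u" for u
      by (simp add: guard_weight_def base_weight_def)
  qed (simp_all add: frac_dominating_guard_weight guard_weight_move pverts_grid)
  \<comment> \<open>The empty grid has no vertex on which to put the extra weight.\<close>
  moreover have "eternally_frac_dominated ?G 0" if "n = 0 \<or> m = 0"
    using eternally_frac_dominated_card[OF pair_graph_grid, of n m] that
    by (auto simp: pverts_grid board_def)
  ultimately obtain S where S: "eternally_frac_dominated ?G S"
    "S \<le> real m * real n / 9 + 16 * (real m + real n) / 9 + 114 / 9"
  proof (cases "n = 0 \<or> m = 0")
    case True
    then show ?thesis using that[of 0] \<open>n = 0 \<or> m = 0 \<Longrightarrow> _\<close> by simp
  qed auto
  then have "\<gamma>\<^sub>f\<^sup>\<infinity> ?G \<le> S"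
    unfolding frac_eternal_domination_number_def
    by (intro cInf_lower bdd_below_eternally_frac_dominated) simp
  with S(2) show ?thesis by simp
qed

end
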